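(* Let $0<\varphi\le\frac{\pi}{2}$, $c=\cos\varphi$, $s=\sin\varphi$, and consider quadratic $G^0$ approximants, with parameter $\xi>0$, of the circular arc $\alpha\mapsto(\cos\alpha,\sin\alpha)^T$, $\alpha\in[-\varphi,\varphi]$. The optimal inner approximant is uniquely determined and is given by $\xi^\lor=2-c$. If $c>0$ (i.e. $\varphi<\frac{\pi}{2}$), the optimal outer approximant is uniquely determined and is given by $\xi^\land=\frac1c$.
   Context: For real $\xi>0$, the quadratic $G^0$ approximant with parameter $\xi$ is the curve $p:[-1,1]\to\mathbb{R}^2$, $p(t)=\sum_{i=0}^2\binom{2}{i}\left(\frac{1+t}{2}\right)^i\left(\frac{1-t}{2}\right)^{2-i}b_i$, with control points $b_0=(c,-s)^T$, $b_1=(\xi,0)^T$, $b_2=(c,s)^T$. Its simplified radial error function is $\psi(t,\xi)=\|p(t)\|_2^2-1$. The approximant is inner if $\psi(t,\xi)\le0$ for all $t\in[-1,1]$, and outer if $\psi(t,\xi)\ge0$ for all $t\in[-1,1]$. An inner (outer) approximant is optimal if it minimizes $\max_{t\in[-1,1]}|\psi(t,\xi)|$ among all inner (outer) approximants of this form. *)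

theory Defs
  imports "HOL-Analysis.Analysis"
begin

definition control_point :: "real \<Rightarrow> real \<Rightarrow> nat \<Rightarrow> real ^ 2" where
  "control_point \<phi> \<xi> i =
     [vector [cos \<phi>, - sin \<phi>], vector [\<xi>, 0], vector [cos \<phi>, sin \<phi>]] ! i"

text \<open>The curve is a total function of \<open>t\<close>; only its values on \<open>[-1, 1]\<close> are used below.\<close>

definition approximant :: "real \<Rightarrow> real \<Rightarrow> real \<Rightarrow> real ^ 2" where
  "approximant \<phi> \<xi> t =
     (\<Sum>i\<le>2. (real (2 choose i) * ((1 + t) / 2) ^ i * ((1 - t) / 2) ^ (2 - i))
        *\<^sub>R control_point \<phi> \<xi> i)"

definition radial_error :: "real \<Rightarrow> real \<Rightarrow> real \<Rightarrow> real" where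
  "radial_error \<phi> t \<xi> = (norm (approximant \<phi> \<xi> t))\<^sup>2 - 1"

text \<open>The supremum is a maximum: \<open>radial_error \<phi> t \<xi>\<close> is polynomial in \<open>t\<close>.\<close>

definition max_radial_error :: "real \<Rightarrow> real \<Rightarrow> real" where
  "max_radial_error \<phi> \<xi> = (SUP t\<in>{-1..1}. \<bar>radial_error \<phi> t \<xi>\<bar>)"

definition inner_approximant :: "real \<Rightarrow> real \<Rightarrow> bool" where
  "inner_approximant \<phi> \<xi> \<longleftrightarrow> \<xi> > 0 \<and> (\<forall>t\<in>{-1..1}. radial_error \<phi> t \<xi> \<le> 0)"

definition outer_approximant :: "real \<Rightarrow> real \<Rightarrow> bool" where
  "outer_approximant \<phi> \<xi> \<longleftrightarrow> \<xi> > 0 \<and> (\<forall>t\<in>{-1..1}. radial_error \<phi> t \<xi> \<ge> 0)"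

definition optimal_inner :: "real \<Rightarrow> real \<Rightarrow> bool" where
  "optimal_inner \<phi> \<xi> \<longleftrightarrow> is_arg_min (max_radial_error \<phi>) (inner_approximant \<phi>) \<xi>"

definition optimal_outer :: "real \<Rightarrow> real \<Rightarrow> bool" where
  "optimal_outer \<phi> \<xi> \<longleftrightarrow> is_arg_min (max_radial_error \<phi>) (outer_approximant \<phi>) \<xi>"

end

theory Submission
  imports Defs
begin

text \<open>
  With \<open>c = cos \<phi>\<close>, \<open>d = \<xi> - c\<close> and \<open>w = 1 - t\<^sup>2\<close>, which ranges over \<open>[0, 1]\<close>, the radial error is
  \<open>w (c d - (1 - c\<^sup>2) + w d\<^sup>2 / 4)\<close>. The second factor increases with \<open>w\<close>, so its value at
  \<open>w = 1\<close> decides whether the approximant is inner, and its limit at \<open>w = 0\<close> whether it is outer;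
  this gives \<open>\<xi> \<le> 2 - c\<close> and \<open>\<xi> \<ge> 1 / c\<close>. At the extremal parameters the error is
  \<open>- (1 - c)\<^sup>2 w (1 - w)\<close> and \<open>w\<^sup>2 d\<^sup>2 / 4\<close>, with extrema at \<open>w = 1/2\<close> and \<open>w = 1\<close>. The error at
  this fixed \<open>w\<close> is already strictly larger in absolute value for every other admissible parameter.
\<close>

text \<open>Gives optimality and uniqueness together from strict comparison with the
  candidate.\<close>

lemma is_arg_min_iff_eq_strict_minimum:
  fixes f :: "'a \<Rightarrow> 'b :: order"
  assumes "P x0" and "\<And>x. P x \<Longrightarrow> x \<noteq> x0 \<Longrightarrow> f x0 < f x"
  shows "is_arg_min f P x \<longleftrightarrow> x = x0"
  using assms unfolding is_arg_min_def by (metis less_asym less_irrefl)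

lemma approximant_components:
  "approximant \<phi> \<xi> t $ 1 = cos \<phi> + (\<xi> - cos \<phi>) * (1 - t\<^sup>2) / 2"
  "approximant \<phi> \<xi> t $ 2 = sin \<phi> * t"
  by (simp_all add: approximant_def control_point_def numeral_2_eq_2 vector_2[unfolded numeral_2_eq_2]
      field_simps power2_eq_square)

text \<open>Writing \<open>1 - c\<^sup>2\<close> for the squared sine leaves a polynomial in
  \<open>c\<close>, \<open>\<xi>\<close> and \<open>w\<close>, so later identities are plain
  algebra.\<close>

definition reduced_error :: "real \<Rightarrow> real \<Rightarrow> real \<Rightarrow> real" where
  "reduced_error c \<xi> w = w * (c * (\<xi> - c) - (1 - c\<^sup>2) + w * (\<xi> - c)\<^sup>2 / 4)"

lemma radial_error_eq_reduced_error:
  "radial_error \<phi> t \<xi> = reduced_error (cos \<phi>) \<xi> (1 - t\<^sup>2)"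
proof -
  have "(norm (approximant \<phi> \<xi> t))\<^sup>2
      = (cos \<phi> + (\<xi> - cos \<phi>) * (1 - t\<^sup>2) / 2)\<^sup>2 + (1 - (cos \<phi>)\<^sup>2) * t\<^sup>2"
    by (simp add: power2_norm_eq_inner inner_vec_def sum_2 approximant_components
        flip: power2_eq_square)
      (simp add: power_mult_distrib sin_squared_eq)
  then show ?thesis
    unfolding radial_error_def reduced_error_def by (simp add: field_simps power2_eq_square)
qed

text \<open>Transfers quantifiers and suprema from \<open>t\<close> to \<open>w\<close>; a preimage
  of \<open>w\<close> is \<open>sqrt (1 - w)\<close>.\<close>

lemma image_one_minus_square: "(\<lambda>t::real. 1 - t\<^sup>2) ` {-1..1} = {0..1}"
proof (intro equalityI subsetI)
  fix w :: real assume "w \<in> {0..1}"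
  then have "w = 1 - (sqrt (1 - w))\<^sup>2" "sqrt (1 - w) \<in> {-1..1}"
    by (auto intro: order_trans[OF _ real_sqrt_ge_zero])
  then show "w \<in> (\<lambda>t::real. 1 - t\<^sup>2) ` {-1..1}" by blast
qed (auto simp: abs_square_le_1 abs_le_iff)

text \<open>Keeping \<open>Q\<close> abstract serves both the inner and the outer sign
  condition.\<close>

lemma ball_radial_error_iff:
  "(\<forall>t\<in>{-1..1}. Q (radial_error \<phi> t \<xi>)) \<longleftrightarrow> (\<forall>w\<in>{0..1}. Q (reduced_error (cos \<phi>) \<xi> w))"
  unfolding radial_error_eq_reduced_error image_one_minus_square[symmetric] by simp

lemma max_radial_error_eq:
  "max_radial_error \<phi> \<xi> = (SUP w\<in>{0..1}. \<bar>reduced_error (cos \<phi>) \<xi> w\<bar>)"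
  unfolding max_radial_error_def radial_error_eq_reduced_error image_one_minus_square[symmetric]
  by (simp add: image_image)

text \<open>Lets one sample point bound the maximum from below; continuity on a compact interval
  bounds the set under the supremum.\<close>

lemma abs_reduced_error_le_max_radial_error:
  assumes "w \<in> {0..1}"
  shows "\<bar>reduced_error (cos \<phi>) \<xi> w\<bar> \<le> max_radial_error \<phi> \<xi>"
  unfolding max_radial_error_eq
proof (rule cSUP_upper[OF assms])
  have "compact ((\<lambda>w. \<bar>reduced_error (cos \<phi>) \<xi> w\<bar>) ` {0..1})"
    unfolding reduced_error_def
    by (intro compact_continuous_image continuous_intros) auto
  then show "bdd_above ((\<lambda>w. \<bar>reduced_error (cos \<phi>) \<xi> w\<bar>) ` {0..1})"
    by (intro bounded_imp_bdd_above compact_imp_bounded)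
qed

lemma max_radial_error_le:
  assumes "\<And>w. 0 \<le> w \<Longrightarrow> w \<le> 1 \<Longrightarrow> \<bar>reduced_error (cos \<phi>) \<xi> w\<bar> \<le> B"
  shows "max_radial_error \<phi> \<xi> \<le> B"
  unfolding max_radial_error_eq by (rule cSUP_least) (use assms in auto)

lemma reduced_error_at_two_minus: "reduced_error c (2 - c) w = - ((1 - c)\<^sup>2 * (w * (1 - w)))"
  unfolding reduced_error_def by (simp add: field_simps power2_eq_square)

lemma reduced_error_at_inverse:
  "c \<noteq> 0 \<Longrightarrow> reduced_error c (1 / c) w = w\<^sup>2 * (1 / c - c)\<^sup>2 / 4"
  unfolding reduced_error_def by (simp add: field_simps power2_eq_square)

lemma optimal_inner_iff:
  assumes "0 \<le> cos \<phi>" "cos \<phi> < 1"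
  shows "optimal_inner \<phi> \<xi> \<longleftrightarrow> \<xi> = 2 - cos \<phi>"
  unfolding optimal_inner_def
proof (rule is_arg_min_iff_eq_strict_minimum)
  let ?c = "cos \<phi>"
  show "inner_approximant \<phi> (2 - ?c)"
    using assms unfolding inner_approximant_def
      ball_radial_error_iff[where Q = "\<lambda>x. x \<le> 0"] reduced_error_at_two_minus by auto
  fix \<xi> assume inner: "inner_approximant \<phi> \<xi>" and ne: "\<xi> \<noteq> 2 - ?c"
  then have pos: "\<xi> > 0" and "reduced_error ?c \<xi> 1 \<le> 0"
    unfolding inner_approximant_def ball_radial_error_iff[where Q = "\<lambda>x. x \<le> 0"] by auto
  \<comment> \<open>At \<open>w = 1\<close>, that is \<open>t = 0\<close>, the curve passes through
    the point \<open>((c + \<xi>) / 2, 0)\<close>.\<close>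
  then have "((?c + \<xi>) / 2)\<^sup>2 \<le> 1"
    unfolding reduced_error_def by (simp add: field_simps power2_eq_square)
  then have "\<xi> < 2 - ?c"
    using ne unfolding abs_square_le_1 abs_le_iff by simp
  have "max_radial_error \<phi> (2 - ?c) \<le> (1 - ?c)\<^sup>2 / 4"
  proof (rule max_radial_error_le)
    fix w :: real assume "0 \<le> w" "w \<le> 1"
    moreover have "w * (1 - w) \<le> 1 / 4"
      using zero_le_power2[of "w - 1 / 2"] by (simp add: field_simps power2_eq_square)
    then have "(1 - ?c)\<^sup>2 * (w * (1 - w)) \<le> (1 - ?c)\<^sup>2 * (1 / 4)"
      by (intro mult_left_mono) auto
    ultimately show "\<bar>reduced_error ?c (2 - ?c) w\<bar> \<le> (1 - ?c)\<^sup>2 / 4"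
      by (simp add: reduced_error_at_two_minus abs_mult)
  qed
  also have "\<dots> < - reduced_error ?c \<xi> (1 / 2)"
  proof -
    \<comment> \<open>The gap between the two sides is quadratic in \<open>\<xi>\<close> and
      vanishes at \<open>2 - c\<close>, hence the first factor; the cofactor is positive since
      \<open>c \<ge> 0\<close> and \<open>\<xi> > 0\<close>.\<close>
    have "0 < (2 - ?c - \<xi>) * (6 * ?c + \<xi> + 2 - ?c)"
      using \<open>\<xi> < 2 - ?c\<close> assms pos by (intro mult_pos_pos) auto
    moreover have "- reduced_error ?c \<xi> (1 / 2) - (1 - ?c)\<^sup>2 / 4
        = (2 - ?c - \<xi>) * (6 * ?c + \<xi> + 2 - ?c) / 16"
      unfolding reduced_error_def by (simp add: field_simps power2_eq_square)
    ultimately show ?thesis by simp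
  qed
  also have "\<dots> \<le> max_radial_error \<phi> \<xi>"
    using abs_reduced_error_le_max_radial_error[of "1 / 2" \<phi> \<xi>] by auto
  finally show "max_radial_error \<phi> (2 - ?c) < max_radial_error \<phi> \<xi>" .
qed

lemma optimal_outer_iff:
  assumes "0 < cos \<phi>"
  shows "optimal_outer \<phi> \<xi> \<longleftrightarrow> \<xi> = 1 / cos \<phi>"
  unfolding optimal_outer_def
proof (rule is_arg_min_iff_eq_strict_minimum)
  let ?c = "cos \<phi>"
  show "outer_approximant \<phi> (1 / ?c)"
    using assms unfolding outer_approximant_def ball_radial_error_iff[where Q = "\<lambda>x. x \<ge> 0"]
    by (auto simp: reduced_error_at_inverse)
  fix \<xi> assume outer: "outer_approximant \<phi> \<xi>" and ne: "\<xi> \<noteq> 1 / ?c"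
  have "1 / ?c \<le> \<xi>"
  proof (rule ccontr)
    define k A where "k = 1 - ?c * \<xi>" and "A = (\<xi> - ?c)\<^sup>2 / 4"
    assume "\<not> 1 / ?c \<le> \<xi>"
    then have "0 < k" using assms by (simp add: k_def field_simps)
    moreover have "0 \<le> A" by (simp add: A_def)
    \<comment> \<open>The error is \<open>w * (w * A - k)\<close>, negative for small
      \<open>w > 0\<close>. The root \<open>k / A\<close> may exceed 1, and \<open>A\<close> may be
      0; enlarging the denominator by \<open>k\<close> gives a valid point in every case.\<close>
    ultimately have "0 < k / (A + k)" "k / (A + k) \<le> 1" "k / (A + k) * A < k"
      by (auto simp: field_simps)
    moreover have "reduced_error ?c \<xi> w = w * (w * A - k)" for w
      unfolding reduced_error_def k_def A_def by (simp add: field_simps power2_eq_square)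
    ultimately have "reduced_error ?c \<xi> (k / (A + k)) < 0"
      by (simp only: mult_less_0_iff) auto
    then show False
      using outer \<open>0 < k / (A + k)\<close> \<open>k / (A + k) \<le> 1\<close>
      unfolding outer_approximant_def ball_radial_error_iff[where Q = "\<lambda>x. x \<ge> 0"]
      by (meson atLeastAtMost_iff less_le not_le)
  qed
  then have "1 / ?c < \<xi>" using ne by simp
  have "max_radial_error \<phi> (1 / ?c) \<le> (1 / ?c - ?c)\<^sup>2 / 4"
  proof (rule max_radial_error_le)
    fix w :: real assume "0 \<le> w" "w \<le> 1"
    then have "w\<^sup>2 \<le> 1" by (simp add: abs_square_le_1)
    then have "w\<^sup>2 * (1 / ?c - ?c)\<^sup>2 \<le> 1 * (1 / ?c - ?c)\<^sup>2"
      by (intro mult_right_mono) auto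
    then show "\<bar>reduced_error ?c (1 / ?c) w\<bar> \<le> (1 / ?c - ?c)\<^sup>2 / 4"
      using assms by (simp add: reduced_error_at_inverse)
  qed
  also have "\<dots> < reduced_error ?c \<xi> 1"
  proof -
    \<comment> \<open>Makes \<open>1 / c - c\<close> nonnegative, so that squaring preserves the
      order.\<close>
    have "?c \<le> 1 / ?c"
      using assms mult_le_one[of ?c ?c] by (simp add: field_simps)
    then have "(1 / ?c - ?c)\<^sup>2 \<le> (\<xi> - ?c)\<^sup>2"
      using \<open>1 / ?c < \<xi>\<close> by (intro power_mono) auto
    moreover have "1 < ?c * \<xi>"
      using \<open>1 / ?c < \<xi>\<close> assms by (simp add: field_simps)
    \<comment> \<open>Strictness comes from the term \<open>c * \<xi> - 1\<close>, which is zero at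
      \<open>\<xi> = 1 / c\<close>.\<close>
    moreover have "reduced_error ?c \<xi> 1 = ?c * \<xi> - 1 + (\<xi> - ?c)\<^sup>2 / 4"
      unfolding reduced_error_def by (simp add: algebra_simps power2_eq_square)
    ultimately show ?thesis by linarith
  qed
  also have "\<dots> \<le> max_radial_error \<phi> \<xi>"
    using abs_reduced_error_le_max_radial_error[of 1 \<phi> \<xi>] by auto
  finally show "max_radial_error \<phi> (1 / ?c) < max_radial_error \<phi> \<xi>" .
qed

theorem mainTheorem3:
  fixes \<phi> c :: real
  assumes "0 < \<phi>" and "\<phi> \<le> pi / 2" and "c = cos \<phi>"
  shows "(\<forall>\<xi>. optimal_inner \<phi> \<xi> \<longleftrightarrow> \<xi> = 2 - c) \<and>
         (c > 0 \<longrightarrow> (\<forall>\<xi>. optimal_outer \<phi> \<xi> \<longleftrightarrow> \<xi> = 1 / c))"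
proof -
  have "0 \<le> cos \<phi>" using assms by (intro cos_ge_zero) auto
  moreover have "cos \<phi> < 1"
    using cos_monotone_0_pi[of 0 \<phi>] assms pi_gt_zero by simp
  ultimately show ?thesis
    using assms(3) optimal_inner_iff optimal_outer_iff by simp
qed

end
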